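(* Let $H$ be a graph such that $\mathcal{P}=H\wedge K_2$ is a $3$-polytope. Then \[\delta(\mathcal{P})=\delta(H)=3.\] In particular, the vertex connectivity of $\mathcal{P}$ is $3$, and the vertex connectivity of $H$ is either $2$ or $3$.
   Context: All graphs are finite and simple; $\delta$ denotes minimum vertex degree. The Kronecker (direct) product $H\wedge J$ of graphs $H,J$ has vertex set $V(H)\times V(J)$ and edge set $\{(a,x)(b,y) : ab\in E(H) \text{ and } xy\in E(J)\}$. For $k\ge 1$, a graph $G$ is $k$-connected if $|V(G)|>k$ and the removal of any fewer than $k$ vertices leaves a connected graph; $G$ has vertex connectivity $k$ if it is $k$-connected but not $(k+1)$-connected. A $3$-polytope is a planar, $3$-connected graph. *)

theory Defs
  imports "HOL-Analysis.Analysis" "Graph_Theory.Graph_Theory"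
begin

text \<open>
  A finite simple graph is a \<^locale>\<open>pair_graph\<close>: a finite, loop-free, symmetric set of ordered
  pairs, where the undirected edge \<open>uv\<close> is represented by the two arcs \<open>(u, v)\<close> and \<open>(v, u)\<close>.
\<close>

definition kronecker_product ::
    "'a pair_pre_digraph \<Rightarrow> 'b pair_pre_digraph \<Rightarrow> ('a \<times> 'b) pair_pre_digraph" where
  "kronecker_product H J =
    \<lparr> pverts = pverts H \<times> pverts J,
      parcs = {((a, x), (b, y)) | a x b y. (a, b) \<in> parcs H \<and> (x, y) \<in> parcs J} \<rparr>"

lemma pair_graph_kronecker_product:
  assumes "pair_graph H" "pair_graph J"
  shows "pair_graph (kronecker_product H J)"
proof -
  interpret H: pair_graph H by fact
  interpret J: pair_graph J by fact
  have "parcs (kronecker_product H J) \<subseteq>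
      (pverts H \<times> pverts J) \<times> (pverts H \<times> pverts J)"
    by (auto simp: kronecker_product_def dest: H.wellformed' J.wellformed')
  then have "finite (parcs (kronecker_product H J))"
    by (rule finite_subset) (simp add: H.pair_finite_verts J.pair_finite_verts)
  then show ?thesis
    by unfold_locales
      (auto simp: kronecker_product_def symmetric_def sym_def
        intro: H.arcs_symmetric J.arcs_symmetric
        dest: H.wellformed' J.wellformed' H.no_loops' J.no_loops')
qed

text \<open>
  In a symmetric digraph the out-degree of a vertex is its number of neighbours. The minimum is
  meaningful only if there is at least one vertex.
\<close>

definition min_degree :: "'a pair_pre_digraph \<Rightarrow> nat" where
  "min_degree G = Min (out_degree (with_proj G) ` pverts G)"

text \<open>
  The notion is intended for \<open>k \<ge> 1\<close>. Connectedness is that of graphs, not the topological one.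
\<close>

definition k_connected :: "nat \<Rightarrow> 'a pair_pre_digraph \<Rightarrow> bool" where
  "k_connected k G \<longleftrightarrow>
    k < card (pverts G) \<and>
    (\<forall>S \<subseteq> pverts G. card S < k \<longrightarrow>
      Digraph_Component.connected (with_proj G \<restriction> (pverts G - S)))"

definition has_vertex_connectivity :: "'a pair_pre_digraph \<Rightarrow> nat \<Rightarrow> bool" where
  "has_vertex_connectivity G k \<longleftrightarrow> k_connected k G \<and> \<not> k_connected (k + 1) G"

text \<open>
  A drawing places the vertices at distinct points \<open>pos v\<close> of the plane and represents the edge
  \<open>uv\<close> by a simple arc (injective continuous image of an interval) from \<open>pos u\<close> to \<open>pos v\<close>, which
  passes through no other vertex; two distinct edges meet only in common endpoints. The two
  orientations \<open>(u, v)\<close>, \<open>(v, u)\<close> of an edge have to trace out the same point set.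
\<close>

definition plane_drawing ::
    "'a pair_pre_digraph \<Rightarrow> ('a \<Rightarrow> complex) \<Rightarrow> ('a \<times> 'a \<Rightarrow> real \<Rightarrow> complex) \<Rightarrow> bool" where
  "plane_drawing G pos \<gamma> \<longleftrightarrow>
    inj_on pos (pverts G) \<and>
    (\<forall>u v. (u, v) \<in> parcs G \<longrightarrow>
      arc (\<gamma> (u, v)) \<and>
      pathstart (\<gamma> (u, v)) = pos u \<and>
      pathfinish (\<gamma> (u, v)) = pos v \<and>
      path_image (\<gamma> (v, u)) = path_image (\<gamma> (u, v)) \<and>
      path_image (\<gamma> (u, v)) \<inter> pos ` pverts G = {pos u, pos v}) \<and>
    (\<forall>u v x y. (u, v) \<in> parcs G \<longrightarrow> (x, y) \<in> parcs G \<longrightarrow> {u, v} \<noteq> {x, y} \<longrightarrow>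
      path_image (\<gamma> (u, v)) \<inter> path_image (\<gamma> (x, y)) \<subseteq> pos ` ({u, v} \<inter> {x, y}))"

definition planar :: "'a pair_pre_digraph \<Rightarrow> bool" where
  "planar G \<longleftrightarrow> (\<exists>pos \<gamma>. plane_drawing G pos \<gamma>)"

definition three_polytope :: "'a pair_pre_digraph \<Rightarrow> bool" where
  "three_polytope G \<longleftrightarrow> planar G \<and> k_connected 3 G"

end

theory Submission
  imports Defs
begin

text \<open>
  The heart of the matter is that a planar bipartite graph, if it is sufficiently connected, has a
  vertex of degree at most three. Since \<open>H \<and> K\<^sub>2\<close> is bipartite and its vertex \<open>(a, x)\<close> has as many
  neighbours as \<open>a\<close> has in \<open>H\<close>, this vertex bounds both minimum degrees by three from above.
  In a \<open>k\<close>-connected graph every degree is at least \<open>k\<close>, because the neighbours of a vertex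
  separate it from the rest. So both minimum degrees are three, and neither graph is
  \<open>4\<close>-connected. Finally \<open>H\<close> is \<open>2\<close>-connected: if removing a set \<open>S\<close> of at most one vertex
  disconnected \<open>H\<close>, then removing the at most two vertices in \<open>S \<times> {x, y}\<close> would disconnect
  \<open>H \<and> K\<^sub>2\<close>.

  The vertex of small degree comes from the bound \<open>\<bar>E\<bar> + 4 \<le> 2\<bar>V\<bar>\<close> for \<open>2\<close>-edge-connected plane
  bipartite graphs (\<open>edge_bound\<close>): if all degrees were at least four, then \<open>\<bar>E\<bar> \<ge> 4\<bar>A\<bar>\<close> and
  \<open>\<bar>E\<bar> \<ge> 4\<bar>B\<bar>\<close> for the two colour classes, so \<open>\<bar>E\<bar> \<ge> 2\<bar>V\<bar>\<close>. As usual, the bound follows from Euler's formula, of which only the inequality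
  \<open>\<bar>E\<bar> + 2 \<le> \<bar>faces\<bar> + \<bar>V\<bar>\<close> is needed, by counting the incidences of faces and edges: each face
  has at least four edges on its boundary, each edge is on the boundary of at most two faces.
  The edges are arbitrary arcs, so the three facts about faces need plane topology. They
  are obtained from the Jordan curve theorem, from the fact that an arc does not separate the
  plane, and from Janiszewski's theorem, that two compact sets with connected intersection do not
  together separate two points which neither of them separates.

  \<^item> A new edge \<open>e\<close> that joins two vertices of a connected drawing forms a Jordan curve
    with an arc of that drawing. There are points near the midpoint of \<open>e\<close> on both sides of this
    curve, so \<open>e\<close> splits a face (\<open>euler_witness_cycle_edge\<close>). Growing a connected subgraph edge
    by edge gives the inequality of Euler.
  \<^item> Let \<open>C\<close> be such a curve through \<open>e\<close> and let \<open>K\<close> be the drawing without \<open>e\<close>. The sets \<open>C\<close> and \<open>K\<close>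
    meet in an arc, so two points in the same face of \<open>K\<close> and on the same side of \<open>C\<close>
    are in the same face of \<open>K \<union> C\<close> (\<open>same_side_imp_same_face\<close>). Hence the face of \<open>K\<close> that contains
    \<open>e\<close> breaks into at most two faces.
  \<^item> The boundary edges of a face separate that face from all other faces. But at most three
    edges of a bipartite graph form a forest, and a forest does not separate the plane
    (\<open>few_edges_do_not_separate\<close>).
\<close>

section \<open>Separation in the plane\<close>

text \<open>
  The closed curve \<open>h +++ c\<close> and \<open>K\<close> intersect exactly in the arc \<open>c\<close>, which is connected, so
  Janiszewski's theorem applies to them.
\<close>

lemma same_side_imp_same_face:
  fixes K :: "complex set"
  assumes "compact K" "arc h" "arc c"
    and ends: "pathstart c = pathfinish h" "pathfinish c = pathstart h"
    and K: "path_image c \<subseteq> K" "path_image h \<inter> K = {pathstart h, pathfinish h}"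
    and ab: "connected_component (- K) a b"
    and side: "connected_component (- path_image (h +++ c)) a b"
  shows "connected_component (- (K \<union> path_image h)) a b"
proof -
  have C: "path_image (h +++ c) = path_image h \<union> path_image c"
    using ends by (simp add: path_image_join)
  have "{pathstart h, pathfinish h} \<subseteq> path_image c"
    using ends by (metis insert_subset empty_subsetI pathfinish_in_path_image pathstart_in_path_image)
  then have "path_image (h +++ c) \<inter> K = path_image c"
    using K C by blast
  moreover have "topological_space_class.connected (path_image c)"
    using \<open>arc c\<close> by (simp add: connected_arc_image)
  moreover have "compact (path_image (h +++ c))"
    using assms(2,3) C by (simp add: compact_Un compact_arc_image)
  ultimately have "connected_component (- (path_image (h +++ c) \<union> K)) a b"
    using Janiszewski[OF _ compact_imp_closed[OF \<open>compact K\<close>] _ side ab] by simp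
  moreover have "path_image (h +++ c) \<union> K = K \<union> path_image h"
    using C K by blast
  ultimately show ?thesis by simp
qed

text \<open>
  A Jordan curve is the frontier of its inside as well as of its outside.
\<close>

lemma both_sides_near_point:
  fixes L :: "complex set"
  assumes "closed L" "m \<notin> L" "simple_path C" "pathfinish C = pathstart C" "m \<in> path_image C"
  obtains i j where "i \<in> inside (path_image C)" "j \<in> outside (path_image C)"
    "connected_component (- L) m i" "connected_component (- L) m j"
proof -
  obtain r where r: "r > 0" "ball m r \<subseteq> - L"
    using assms by (metis ComplI open_Compl open_contains_ball)
  have comp: "connected_component (- L) m z" if "z \<in> ball m r" for z
    using that r by (intro connected_componentI[of "ball m r"]) auto
  have "m \<in> frontier (inside (path_image C))" "m \<in> frontier (outside (path_image C))"
    using Jordan_inside_outside[OF assms(3,4)] assms(5) by auto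
  then have "inside (path_image C) \<inter> ball m r \<noteq> {}" "outside (path_image C) \<inter> ball m r \<noteq> {}"
    using r(1) unfolding frontier_straddle by (fastforce simp: mem_ball)+
  then show thesis using that comp by blast
qed

lemma inside_outside_separated:
  assumes "i \<in> inside C" "j \<in> outside C" "C \<subseteq> M"
  shows "\<not> connected_component (- M) i j"
proof
  assume "connected_component (- M) i j"
  then have "connected_component (- C) i j"
    by (rule connected_component_of_subset) (use assms(3) in auto)
  then have "j \<in> inside C" using assms(1) inside_same_component by metis
  with assms(2) show False using inside_Int_outside by blast
qed

lemma connected_component_avoid_finite:
  fixes T :: "complex set"
  assumes "closed T" "finite W" "connected_component (- T) x y" "x \<notin> W" "y \<notin> W"
  shows "connected_component (- (W \<union> T)) x y"
proof -
  let ?U = "connected_component_set (- T) x"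
  have "path_connected (?U - W)"
    using assms by (intro path_connected_open_diff_countable)
      (auto simp: open_connected_component open_Compl uncountable_infinite countable_finite)
  then have "topological_space_class.connected (?U - W)" by (rule path_connected_imp_connected)
  moreover have "?U - W \<subseteq> - (W \<union> T)" using connected_component_subset[of "- T" x] by blast
  moreover have "x \<in> ?U - W" "y \<in> ?U - W"
    using assms connected_component_in[of "- T" x y] by auto
  ultimately show ?thesis by (rule connected_componentI)
qed

section \<open>Bipartite plane graphs and their faces\<close>

text \<open>
  Vertices are identified with the points that represent them. Every edge is listed only once,
  directed from the colour class \<open>A\<close> to the colour class \<open>B\<close>.
\<close>

locale plane_bipartite_graph =
  fixes A B :: "complex set" and E :: "(complex \<times> complex) set"
    and g :: "complex \<times> complex \<Rightarrow> real \<Rightarrow> complex"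
  assumes finite_A: "finite A" and finite_B: "finite B" and disjoint: "A \<inter> B = {}"
    and edges: "E \<subseteq> A \<times> B"
    and arc_g: "e \<in> E \<Longrightarrow> arc (g e)"
    and start_g: "e \<in> E \<Longrightarrow> pathstart (g e) = fst e"
    and finish_g: "e \<in> E \<Longrightarrow> pathfinish (g e) = snd e"
    and vertices_on_edge: "e \<in> E \<Longrightarrow> path_image (g e) \<inter> (A \<union> B) = {fst e, snd e}"
    and edge_Int: "e \<in> E \<Longrightarrow> e' \<in> E \<Longrightarrow> e \<noteq> e' \<Longrightarrow>
      path_image (g e) \<inter> path_image (g e') \<subseteq> {fst e, snd e} \<inter> {fst e', snd e'}"
begin

abbreviation V :: "complex set" where "V \<equiv> A \<union> B"

definition drawing :: "(complex \<times> complex) set \<Rightarrow> complex set" where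
  "drawing F = V \<union> (\<Union>e\<in>F. path_image (g e))"

definition midpt :: "complex \<times> complex \<Rightarrow> complex" where "midpt e = g e (1/2)"

lemma finite_E: "finite E"
  using edges finite_A finite_B by (meson finite_SigmaI finite_subset)

lemma edge_ends: "e \<in> E \<Longrightarrow> fst e \<in> A" "e \<in> E \<Longrightarrow> snd e \<in> B"
  "e \<in> E \<Longrightarrow> fst e \<noteq> snd e"
  using edges disjoint by (metis IntI emptyE mem_Times_iff subsetD)+

lemma ends_in: "e \<in> E \<Longrightarrow> fst e \<in> path_image (g e)" "e \<in> E \<Longrightarrow> snd e \<in> path_image (g e)"
  using vertices_on_edge by blast+

lemma compact_edges: "F \<subseteq> E \<Longrightarrow> compact (\<Union>e\<in>F. path_image (g e))"
  using finite_E by (intro compact_UN) (auto intro: finite_subset compact_arc_image arc_g)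

lemma compact_drawing: "F \<subseteq> E \<Longrightarrow> compact (drawing F)"
  unfolding drawing_def using compact_edges finite_A finite_B
  by (intro compact_Un) (auto simp: finite_imp_compact)

lemma closed_drawing: "F \<subseteq> E \<Longrightarrow> closed (drawing F)"
  by (simp add: compact_drawing compact_imp_closed)

lemma drawing_remove: "e \<in> E \<Longrightarrow> drawing E = drawing (E - {e}) \<union> path_image (g e)"
  unfolding drawing_def by blast

lemma drawing_mono: "F \<subseteq> F' \<Longrightarrow> drawing F \<subseteq> drawing F'"
  unfolding drawing_def by blast

lemma edge_Int_drawing:
  assumes "e \<in> E" shows "path_image (g e) \<inter> drawing (E - {e}) = {fst e, snd e}"
  unfolding drawing_def using vertices_on_edge[OF assms] edge_Int[OF assms] by blast

lemma interior_edge: "e \<in> E \<Longrightarrow> g e ` {0<..<1} = path_image (g e) - {fst e, snd e}"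
  using simple_path_endless[OF arc_imp_simple_path[OF arc_g]] start_g finish_g by metis

lemma midpt_in: "e \<in> E \<Longrightarrow> midpt e \<in> path_image (g e) - {fst e, snd e}"
  unfolding interior_edge[symmetric] midpt_def by auto

lemma midpt_notin: "e \<in> E \<Longrightarrow> midpt e \<notin> drawing (E - {e})"
  using midpt_in edge_Int_drawing by blast

lemma interior_edge_component:
  assumes "e \<in> E" "z \<in> path_image (g e) - {fst e, snd e}"
  shows "connected_component (- drawing (E - {e})) z (midpt e)"
proof (rule connected_componentI)
  show "topological_space_class.connected (path_image (g e) - {fst e, snd e})"
    using connected_simple_path_endless[OF arc_imp_simple_path[OF arc_g]] start_g finish_g assms(1)
    by metis
  show "path_image (g e) - {fst e, snd e} \<subseteq> - drawing (E - {e})"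
    using edge_Int_drawing[OF assms(1)] by blast
qed (use assms midpt_in in auto)

text \<open>
  The point \<open>x\<close> stands for the face that contains it. An edge \<open>e\<close> counts as a boundary edge of that
  face if deleting \<open>e\<close> merges the face with the inner points of \<open>e\<close>. By
  \<open>interior_edge_component\<close> all inner points behave alike, so the midpoint represents them.
\<close>

definition bounds :: "complex \<times> complex \<Rightarrow> complex \<Rightarrow> bool" where
  "bounds e x \<longleftrightarrow> connected_component (- drawing (E - {e})) x (midpt e)"

text \<open>
  A set of edges in which each end of each edge is also the end of another edge contains a cycle,
  and a cycle in a bipartite graph has at least four edges.
\<close>

lemma small_edge_set_has_leaf:
  assumes "F \<noteq> {}" "finite F" "card F \<le> 3"
  obtains (leaf) e where "e \<in> F"
    "(\<forall>e'\<in>F - {e}. fst e' \<noteq> fst e) \<or> (\<forall>e'\<in>F - {e}. snd e' \<noteq> snd e)"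
proof (rule ccontr)
  assume "\<not> thesis"
  then have fs: "\<exists>e'\<in>F - {e}. fst e' = fst e" "\<exists>e'\<in>F - {e}. snd e' = snd e" if "e \<in> F" for e
    using that \<open>\<not> thesis\<close> leaf by blast+
  obtain e where e: "e \<in> F" using assms by blast
  obtain e1 where e1: "e1 \<in> F" "e1 \<noteq> e" "fst e1 = fst e" using fs(1)[OF e] by blast
  obtain e2 where e2: "e2 \<in> F" "e2 \<noteq> e" "snd e2 = snd e" using fs(2)[OF e] by blast
  obtain e3 where e3: "e3 \<in> F" "e3 \<noteq> e1" "snd e3 = snd e1" using fs(2)[OF e1(1)] by blast
  have "snd e1 \<noteq> snd e" using e1 by (metis prod_eqI)
  then have "card {e, e1, e2, e3} = 4" using e1 e2 e3
    by (auto simp: card_insert_if)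
  moreover have "{e, e1, e2, e3} \<subseteq> F" using e e1 e2 e3 by auto
  ultimately show False using assms card_mono[of F "{e, e1, e2, e3}"] by simp
qed

text \<open>
  An edge with a leaf meets the remaining edges in at most one point, so by Janiszewski's theorem
  it can be added without separating anything. The isolated vertices are added last; finitely many
  points do not disconnect an open connected subset of the plane.
\<close>

lemma few_edges_do_not_separate:
  assumes "F \<subseteq> E" "card F \<le> 3" "x \<notin> drawing F" "y \<notin> drawing F"
  shows "connected_component (- drawing F) x y"
proof -
  let ?D = "\<lambda>F. \<Union>e\<in>F. path_image (g e)"
  have "connected_component (- ?D F) x y" if "finite F" "F \<subseteq> E" "card F \<le> 3"
      "x \<notin> ?D F" "y \<notin> ?D F" for F
    using that
  proof (induction F rule: finite_psubset_induct)
    case (psubset F)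
    show ?case
    proof (cases "F = {}")
      case True
      then show ?thesis using connected_UNIV by (auto intro: connected_componentI[of UNIV])
    next
      case False
      then obtain e where e: "e \<in> F"
          "(\<forall>e'\<in>F - {e}. fst e' \<noteq> fst e) \<or> (\<forall>e'\<in>F - {e}. snd e' \<noteq> snd e)"
        using small_edge_set_has_leaf psubset by metis
      have "card (F - {e}) \<le> 3" using psubset e by (simp add: card_Diff1_le le_trans)
      then have IH: "connected_component (- ?D (F - {e})) x y"
        using psubset e by (intro psubset.IH) auto
      have meet: "path_image (g e) \<inter> path_image (g e') \<subseteq>
          (if fst e' = fst e then {fst e} else {}) \<union> (if snd e' = snd e then {snd e} else {})"
        if "e' \<in> F - {e}" for e'
      proof -
        have E: "e \<in> E" "e' \<in> E" "e \<noteq> e'" using that e(1) psubset.prems by auto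
        have "fst e' \<noteq> snd e" "snd e' \<noteq> fst e"
          using edge_ends[OF E(1)] edge_ends[OF E(2)] disjoint by auto
        then show ?thesis using edge_Int[OF E] by auto
      qed
      have "path_image (g e) \<inter> ?D (F - {e}) \<subseteq> {snd e} \<or>
          path_image (g e) \<inter> ?D (F - {e}) \<subseteq> {fst e}"
        using e(2)
      proof (elim disj_forward)
        assume "\<forall>e'\<in>F - {e}. fst e' \<noteq> fst e"
        then have "path_image (g e) \<inter> path_image (g e') \<subseteq> {snd e}" if "e' \<in> F - {e}" for e'
          using meet[OF that] that by (auto split: if_splits)
        then show "path_image (g e) \<inter> ?D (F - {e}) \<subseteq> {snd e}" by auto
      next
        assume "\<forall>e'\<in>F - {e}. snd e' \<noteq> snd e"
        then have "path_image (g e) \<inter> path_image (g e') \<subseteq> {fst e}" if "e' \<in> F - {e}" for e'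
          using meet[OF that] that by (auto split: if_splits)
        then show "path_image (g e) \<inter> ?D (F - {e}) \<subseteq> {fst e}" by auto
      qed
      then have "topological_space_class.connected (path_image (g e) \<inter> ?D (F - {e}))"
        by (metis connected_empty connected_sing subset_singletonD)
      moreover have "e \<in> E" using e psubset by auto
      moreover have "connected_component (- path_image (g e)) x y"
        using connected_arc_complement[OF arc_g[OF \<open>e \<in> E\<close>]] psubset.prems e
        by (intro connected_componentI[of "- path_image (g e)"]) auto
      moreover have "closed (?D (F - {e}))"
        using psubset by (intro compact_imp_closed compact_edges) auto
      ultimately have "connected_component (- (path_image (g e) \<union> ?D (F - {e}))) x y"
        using IH by (intro Janiszewski) (auto simp: compact_arc_image arc_g)
      moreover have "path_image (g e) \<union> ?D (F - {e}) = ?D F" using e by blast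
      ultimately show ?thesis by simp
    qed
  qed
  then have "connected_component (- ?D F) x y"
    using assms finite_E by (auto simp: drawing_def intro: finite_subset)
  then show ?thesis
    unfolding drawing_def using assms finite_A finite_B compact_edges
    by (intro connected_component_avoid_finite) (auto simp: drawing_def compact_imp_closed)
qed

text \<open>
  A connected set that leaves the face of \<open>x\<close> but avoids the boundary edges crosses the
  frontier of the face at an inner point \<open>z\<close> of some other edge \<open>e\<close>. A disc around \<open>z\<close> that
  misses all edges but \<open>e\<close> meets the face, so \<open>e\<close> bounds the face after all.
\<close>

lemma boundary_edges_separate:
  assumes "x \<notin> drawing E" "y \<notin> drawing E"
    and "connected_component (- drawing {e \<in> E. bounds e x}) x y"
  shows "connected_component (- drawing E) x y"
proof (rule ccontr)
  let ?U = "connected_component_set (- drawing E) x"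
  assume "\<not> connected_component (- drawing E) x y"
  then have y: "y \<notin> ?U" by simp
  obtain S where S: "topological_space_class.connected S" "S \<subseteq> - drawing {e \<in> E. bounds e x}"
      "x \<in> S" "y \<in> S"
    using assms(3) unfolding connected_component_def by blast
  have "x \<in> ?U" using assms by simp
  then obtain z where z: "z \<in> S" "z \<in> frontier ?U"
    using connected_Int_frontier[of S ?U] S y by blast
  have "z \<in> drawing E"
    using z(2) frontier_of_connected_component_subset[of "- drawing E" x]
      frontier_complement[of "drawing E"] closed_drawing[of E] frontier_subset_closed by blast
  then obtain e where e: "e \<in> E" "z \<in> path_image (g e)" "\<not> bounds e x" "z \<notin> V"
    using z(1) S(2) unfolding drawing_def by blast
  then have zi: "z \<in> path_image (g e) - {fst e, snd e}" using edge_ends(1,2)[OF e(1)] by auto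
  then have "z \<notin> drawing (E - {e})" using edge_Int_drawing[OF e(1)] by blast
  then obtain r where r: "r > 0" "ball z r \<subseteq> - drawing (E - {e})"
    by (metis ComplI open_Compl open_contains_ball closed_drawing Diff_subset)
  obtain w where w: "w \<in> ?U" "w \<in> ball z r"
    using z(2) r(1) unfolding frontier_straddle by (fastforce simp: mem_ball)
  have "connected_component (- drawing (E - {e})) x w"
    using w(1) drawing_mono[of "E - {e}" E]
    by (auto intro: connected_component_of_subset)
  moreover have "connected_component (- drawing (E - {e})) w z"
    using w r by (intro connected_componentI[of "ball z r"]) auto
  ultimately have "bounds e x"
    unfolding bounds_def using interior_edge_component[OF e(1) zi] connected_component_trans by metis
  with e(3) show False by contradiction
qed

text \<open>
  The arc \<open>c\<close> takes the place of a path in the graph without \<open>e\<close> between the ends of \<open>e\<close>. That it is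
  any arc in the drawing, rather than a sequence of edges, lets arcwise connectedness of the drawing
  provide it.
\<close>

lemma edge_closes_simple_cycle:
  assumes e: "e \<in> E"
    and c: "arc c" "path_image c \<subseteq> drawing (E - {e})" "pathstart c = snd e" "pathfinish c = fst e"
  shows "simple_path (g e +++ c)" "pathfinish (g e +++ c) = pathstart (g e +++ c)"
    "path_image (g e +++ c) = path_image (g e) \<union> path_image c"
proof -
  have "path_image (g e) \<inter> path_image c \<subseteq> {pathstart (g e), pathstart c}"
    using edge_Int_drawing[OF e] c start_g[OF e] by auto
  then show "simple_path (g e +++ c)"
    using e c by (intro simple_path_join_loop) (auto simp: arc_g start_g finish_g)
qed (use e c in \<open>auto simp: path_image_join start_g finish_g\<close>)

lemma same_side_of_edge_imp_same_face:
  assumes e: "e \<in> E"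
    and c: "arc c" "path_image c \<subseteq> drawing (E - {e})" "pathstart c = snd e" "pathfinish c = fst e"
    and ab: "bounds e a" "bounds e b"
    and side: "a \<in> inside (path_image (g e +++ c)) \<longleftrightarrow> b \<in> inside (path_image (g e +++ c))"
    and off: "a \<notin> drawing E" "b \<notin> drawing E"
  shows "connected_component (- drawing E) a b"
proof -
  let ?C = "path_image (g e +++ c)"
  have C: "?C = path_image (g e) \<union> path_image c"
    using c finish_g[OF e] by (simp add: path_image_join)
  have "?C \<subseteq> drawing E" using C c(2) drawing_remove[OF e] by blast
  then have out: "a \<notin> ?C" "b \<notin> ?C" using off by auto
  have J: "topological_space_class.connected (inside ?C)"
      "topological_space_class.connected (outside ?C)" "inside ?C \<union> outside ?C = - ?C"
    using Jordan_inside_outside[OF edge_closes_simple_cycle(1,2)[OF e c]] by simp_all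
  then have sub: "inside ?C \<subseteq> - ?C" "outside ?C \<subseteq> - ?C" by blast+
  have "connected_component (- ?C) a b"
  proof (cases "a \<in> inside ?C")
    case True
    then show ?thesis using side sub by (intro connected_componentI[OF J(1)]) auto
  next
    case False
    then have "a \<in> outside ?C" "b \<in> outside ?C" using J(3) out side by blast+
    then show ?thesis using sub by (intro connected_componentI[OF J(2)]) auto
  qed
  moreover have "connected_component (- drawing (E - {e})) a b"
    using ab unfolding bounds_def by (meson connected_component_sym connected_component_trans)
  ultimately show ?thesis
    unfolding drawing_remove[OF e]
    using e c edge_Int_drawing[OF e]
    by (intro same_side_imp_same_face[where c = c])
      (simp_all add: compact_drawing arc_g start_g finish_g)
qed

text \<open>
  The set \<open>M\<close> is arbitrary because the two points are to be separated by a growing subgraph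
  as well as by the whole drawing.
\<close>

lemma faces_on_both_sides:
  assumes e: "e \<in> E"
    and c: "arc c" "path_image c \<subseteq> drawing (E - {e})" "pathstart c = snd e" "pathfinish c = fst e"
  obtains i j where "bounds e i" "bounds e j" "i \<notin> drawing E" "j \<notin> drawing E"
    "\<And>M. path_image (g e) \<union> path_image c \<subseteq> M \<Longrightarrow> \<not> connected_component (- M) i j"
proof -
  define C where "C = g e +++ c"
  have cyc: "simple_path C" "pathfinish C = pathstart C"
      "path_image C = path_image (g e) \<union> path_image c"
    using edge_closes_simple_cycle[OF e c] unfolding C_def by blast+
  have "midpt e \<in> path_image C" using midpt_in[OF e] cyc(3) by blast
  then obtain i j where ij: "i \<in> inside (path_image C)" "j \<in> outside (path_image C)"
    "connected_component (- drawing (E - {e})) (midpt e) i"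
    "connected_component (- drawing (E - {e})) (midpt e) j"
    using both_sides_near_point[OF closed_drawing midpt_notin[OF e] cyc(1,2)] by blast
  have "i \<notin> path_image C" "j \<notin> path_image C"
    using ij(1,2) inside_no_overlap outside_no_overlap by blast+
  moreover have "i \<notin> drawing (E - {e})" "j \<notin> drawing (E - {e})"
    using ij(3,4) connected_component_in by fastforce+
  ultimately have "i \<notin> drawing E" "j \<notin> drawing E"
    using cyc(3) drawing_remove[OF e] by auto
  then show thesis
    using that[of i j] ij inside_outside_separated[OF ij(1,2)] cyc(3) connected_component_sym
    unfolding bounds_def by metis
qed

text \<open>
  The faces at \<open>e\<close> are told apart by the side of a Jordan curve through \<open>e\<close> on which they lie.
\<close>

lemma edge_bounds_at_most_two_faces:
  assumes e: "e \<in> E"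
    and c: "arc c" "path_image c \<subseteq> drawing (E - {e})" "pathstart c = snd e" "pathfinish c = fst e"
    and X: "X \<inter> drawing E = {}"
      "\<And>x y. x \<in> X \<Longrightarrow> y \<in> X \<Longrightarrow> x \<noteq> y \<Longrightarrow> \<not> connected_component (- drawing E) x y"
  shows "card {x \<in> X. bounds e x} \<le> 2"
proof -
  let ?side = "\<lambda>x. x \<in> inside (path_image (g e +++ c))"
  \<comment> \<open>Being inside the curve is one bit, so injectivity leaves at most two points.\<close>
  have "inj_on ?side {x \<in> X. bounds e x}"
    using same_side_of_edge_imp_same_face[OF e c] X by (intro inj_onI) blast
  then have "card {x \<in> X. bounds e x} \<le> card (UNIV :: bool set)"
    by (rule card_inj_on_le) auto
  then show ?thesis by simp
qed

section \<open>Euler's inequality for connected subgraphs\<close>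

definition plane_subgraph :: "complex set \<Rightarrow> (complex \<times> complex) set \<Rightarrow> complex set" where
  "plane_subgraph W F = W \<union> (\<Union>e\<in>F. path_image (g e))"

lemma plane_subgraph_subset:
  "W \<subseteq> V \<Longrightarrow> e \<notin> F \<Longrightarrow> F \<subseteq> E \<Longrightarrow> plane_subgraph W F \<subseteq> drawing (E - {e})"
  unfolding plane_subgraph_def drawing_def by blast

lemma plane_subgraph_insert:
  "plane_subgraph W (insert e F) = plane_subgraph W F \<union> path_image (g e)"
  unfolding plane_subgraph_def by blast

text \<open>
  \<open>X\<close> consists of points in different faces of the connected subgraph \<open>(W, F)\<close>, and there are
  enough of them for the inequality in Euler's formula. The points avoid the whole drawing and not
  only the subgraph, so that they stay valid when the subgraph grows.
\<close>

definition euler_witness :: "complex set \<Rightarrow> (complex \<times> complex) set \<Rightarrow> complex set \<Rightarrow> bool" where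
  "euler_witness W F X \<longleftrightarrow> W \<subseteq> V \<and> W \<noteq> {} \<and> F \<subseteq> E \<and> F \<subseteq> W \<times> W \<and>
    path_connected (plane_subgraph W F) \<and> finite X \<and> X \<inter> drawing E = {} \<and>
    (\<forall>x\<in>X. \<forall>y\<in>X. x \<noteq> y \<longrightarrow> \<not> connected_component (- plane_subgraph W F) x y) \<and>
    card F + 2 \<le> card X + card W"

text \<open>
  A pendant edge brings one new vertex and needs no new face.
\<close>

lemma euler_witness_pendant_edge:
  assumes w: "euler_witness W F X" and e: "e \<in> E" "e \<notin> F" "(fst e \<in> W) \<noteq> (snd e \<in> W)"
  shows "euler_witness (insert (fst e) (insert (snd e) W)) (insert e F) X"
proof -
  let ?W = "insert (fst e) (insert (snd e) W)"
  have W: "W \<subseteq> V" "F \<subseteq> E" "F \<subseteq> W \<times> W" "finite W" "finite F"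
    using w finite_subset[of W V] finite_subset[of F E] finite_A finite_B finite_E
    unfolding euler_witness_def by blast+
  have eq: "plane_subgraph ?W (insert e F) = plane_subgraph W F \<union> path_image (g e)"
    using ends_in[OF e(1)] unfolding plane_subgraph_def by auto
  have "path_connected (plane_subgraph W F \<union> path_image (g e))"
  proof (rule path_connected_Un)
    show "path_connected (plane_subgraph W F)" using w by (simp add: euler_witness_def)
    show "path_connected (path_image (g e))"
      using e by (simp add: arc_g arc_imp_path path_connected_path_image)
    show "plane_subgraph W F \<inter> path_image (g e) \<noteq> {}"
      using ends_in[OF e(1)] e(3) unfolding plane_subgraph_def by blast
  qed
  moreover have "card ?W = card W + 1"
    using e(3) W by (cases "fst e \<in> W") (auto simp: insert_absorb)
  moreover have "\<not> connected_component (- (plane_subgraph W F \<union> path_image (g e))) x y"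
    if "x \<in> X" "y \<in> X" "x \<noteq> y" for x y
    using w that connected_component_of_subset[of _ x y "- plane_subgraph W F"]
    unfolding euler_witness_def by blast
  moreover have "card (insert e F) = card F + 1" using e W by simp
  moreover have "insert e F \<subseteq> ?W \<times> ?W" using W(3) by (auto simp: mem_Times_iff)
  moreover have "?W \<subseteq> V" using W(1) edge_ends[OF e(1)] by blast
  moreover have "finite X" "X \<inter> drawing E = {}" "card F + 2 \<le> card X + card W"
    using w unfolding euler_witness_def by blast+
  ultimately show ?thesis
    using e(1) W(2) unfolding euler_witness_def eq by (intro conjI ballI impI) simp_all
qed

text \<open>
  The face of the subgraph in which the new edge runs contains at most one point of \<open>X\<close>. Two
  points, one on each side of the new edge, take its place.
\<close>

lemma euler_witness_cycle_edge:
  assumes w: "euler_witness W F X" and e: "e \<in> E" "e \<notin> F" "fst e \<in> W" "snd e \<in> W"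
  obtains X' where "euler_witness W (insert e F) X'"
proof -
  let ?M = "plane_subgraph W F"
  have W: "W \<subseteq> V" "F \<subseteq> E" "F \<subseteq> W \<times> W" "finite W" "finite F" "finite X" "path_connected ?M"
    using w finite_subset[of W V] finite_subset[of F E] finite_A finite_B finite_E
    unfolding euler_witness_def by blast+
  have sep: "\<not> connected_component (- ?M) x y" if "x \<in> X" "y \<in> X" "x \<noteq> y" for x y
    using w that unfolding euler_witness_def by blast
  have M_sub: "?M \<subseteq> drawing (E - {e})" using W e plane_subgraph_subset by blast
  have "fst e \<in> ?M" "snd e \<in> ?M" using e unfolding plane_subgraph_def by auto
  then obtain c where c: "arc c" "path_image c \<subseteq> ?M" "pathstart c = snd e" "pathfinish c = fst e"
    using W(7) edge_ends(3)[OF e(1)] unfolding path_connected_arcwise by metis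
  obtain i j where "bounds e i" "bounds e j" and off: "i \<notin> drawing E" "j \<notin> drawing E"
      and apart: "\<And>M. path_image (g e) \<union> path_image c \<subseteq> M \<Longrightarrow> \<not> connected_component (- M) i j"
    using faces_on_both_sides[OF e(1) c(1) _ c(3,4)] c(2) M_sub by blast
  then have ijM: "connected_component (- ?M) (midpt e) i" "connected_component (- ?M) (midpt e) j"
    using M_sub unfolding bounds_def
    by (meson Compl_subset_Compl_iff connected_component_of_subset connected_component_sym)+
  have M': "plane_subgraph W (insert e F) = ?M \<union> path_image (g e)"
    by (rule plane_subgraph_insert)
  let ?M' = "?M \<union> path_image (g e)"
  \<comment> \<open>The points of \<open>X\<close> outside the face that \<open>e\<close> splits.\<close>
  define X0 where "X0 = {x \<in> X. \<not> connected_component (- ?M) (midpt e) x}"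
  have ij_sep: "\<not> connected_component (- ?M') i j"
    using c(2) by (intro apart) auto
  have restr: "connected_component (- ?M) x y" if "connected_component (- ?M') x y" for x y
    using that by (rule connected_component_of_subset) blast
  have X0_sep: "\<not> connected_component (- ?M') x z"
    if "x \<in> X0" "connected_component (- ?M) (midpt e) z" for x z
  proof
    assume "connected_component (- ?M') x z"
    then have "connected_component (- ?M) z x" by (rule connected_component_sym[OF restr])
    with that(2) have "connected_component (- ?M) (midpt e) x" by (rule connected_component_trans)
    with that(1) show False unfolding X0_def by simp
  qed
  have "card (X - X0) \<le> 1"
  proof -
    have "x = y" if "x \<in> X - X0" "y \<in> X - X0" for x y
    proof (rule ccontr)
      assume "x \<noteq> y"
      have "connected_component (- ?M) (midpt e) x" "connected_component (- ?M) (midpt e) y"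
        using that unfolding X0_def by auto
      then have "connected_component (- ?M) x y"
        by (blast intro: connected_component_sym connected_component_trans)
      with sep[of x y] that \<open>x \<noteq> y\<close> show False by blast
    qed
    then show ?thesis using card_le_Suc0_iff_eq[of "X - X0"] W(6) by auto
  qed
  moreover have "card X0 + card (X - X0) = card X"
    using W(6) by (metis (no_types, lifting) X0_def card_Diff_subset card_mono finite_subset
        le_add_diff_inverse mem_Collect_eq subsetI)
  moreover have "i \<notin> X0" "j \<notin> X0" using ijM unfolding X0_def by auto
  moreover have "i \<noteq> j"
  proof -
    have "path_image (g e) \<union> path_image c \<subseteq> drawing E"
      using c(2) M_sub drawing_remove[OF e(1)] by blast
    then have "\<not> connected_component (- drawing E) i j" by (rule apart)
    then show ?thesis using off(1) by auto
  qed
  moreover have "finite X0" using W(6) unfolding X0_def by simp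
  ultimately have "card X + 1 \<le> card (insert i (insert j X0))" by simp
  moreover have "card (insert e F) = card F + 1" using W e by simp
  moreover have "card F + 2 \<le> card X + card W" using w unfolding euler_witness_def by simp
  ultimately have "card (insert e F) + 2 \<le> card (insert i (insert j X0)) + card W" by linarith
  moreover have "path_connected ?M'"
  proof (rule path_connected_Un)
    show "path_connected (path_image (g e))"
      using e by (simp add: arc_g arc_imp_path path_connected_path_image)
    show "?M \<inter> path_image (g e) \<noteq> {}"
      using ends_in[OF e(1)] e(3) unfolding plane_subgraph_def by blast
  qed (rule W(7))
  moreover have "\<not> connected_component (- ?M') x y"
    if "x \<in> insert i (insert j X0)" "y \<in> insert i (insert j X0)" "x \<noteq> y" for x y
  proof -
    have new: "\<not> connected_component (- ?M') u x \<and> \<not> connected_component (- ?M') x u"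
      if "x \<in> X0" "u = i \<or> u = j" for x u
      using X0_sep[OF that(1)] ijM that(2) connected_component_sym[of "- ?M'"] by blast
    have "\<not> connected_component (- ?M') j i" using ij_sep connected_component_sym by blast
    moreover have "\<not> connected_component (- ?M') x y" if "x \<in> X0" "y \<in> X0"
      using sep[of x y] restr[of x y] that \<open>x \<noteq> y\<close> unfolding X0_def by blast
    ultimately show ?thesis using that ij_sep new by blast
  qed
  moreover have "insert i (insert j X0) \<inter> drawing E = {}"
    using off w unfolding euler_witness_def X0_def by blast
  moreover have "insert e F \<subseteq> W \<times> W" using W(3) e by (auto simp: mem_Times_iff)
  moreover have "W \<noteq> {}" using e by blast
  ultimately have "euler_witness W (insert e F) (insert i (insert j X0))"
    using W(1,2) e(1) \<open>finite X0\<close> unfolding euler_witness_def M'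
    by (intro conjI ballI impI) simp_all
  then show thesis by (rule that)
qed

end

section \<open>The number of edges of a plane bipartite graph\<close>

text \<open>
  Connectivity is expressed by cuts, since a cut is what supplies the next edge for a growing
  subgraph. That each cut has two edges says in addition that there are no bridges.
\<close>

locale two_edge_connected_plane_bipartite_graph = plane_bipartite_graph +
  assumes two_crossing_edges: "W \<subseteq> A \<union> B \<Longrightarrow> W \<noteq> {} \<Longrightarrow> W \<noteq> A \<union> B \<Longrightarrow>
      \<exists>e\<in>E. \<exists>e'\<in>E. e \<noteq> e' \<and> (fst e \<in> W) \<noteq> (snd e \<in> W) \<and> (fst e' \<in> W) \<noteq> (snd e' \<in> W)"
    and nonempty: "E \<noteq> {}"
begin

text \<open>
  The vertices that can be reached from one end of \<open>e\<close> without using \<open>e\<close> form a set whose only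
  crossing edge could be \<open>e\<close>.
\<close>

lemma nonbridge:
  assumes e: "e \<in> E"
  obtains c where "arc c" "path_image c \<subseteq> drawing (E - {e})"
    "pathstart c = snd e" "pathfinish c = fst e"
proof -
  let ?K = "drawing (E - {e})"
  define W where "W = {v \<in> V. path_component ?K (snd e) v}"
  have s: "snd e \<in> V" "fst e \<in> V" using edge_ends[OF e] by auto
  then have "snd e \<in> ?K" unfolding drawing_def by auto
  then have "snd e \<in> W" using s unfolding W_def by (simp add: path_component_refl)
  have "fst e \<in> W"
  proof (rule ccontr)
    assume "fst e \<notin> W"
    then have "W \<subseteq> V" "W \<noteq> {}" "W \<noteq> V" using s \<open>snd e \<in> W\<close> unfolding W_def by auto
    then obtain e' where e': "e' \<in> E" "e' \<noteq> e" "(fst e' \<in> W) \<noteq> (snd e' \<in> W)"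
      using two_crossing_edges by metis
    have "path_component ?K (fst e') (snd e')"
      unfolding path_component_def
      using arc_imp_path[OF arc_g[OF e'(1)]] start_g[OF e'(1)] finish_g[OF e'(1)] e'
      by (intro exI[of _ "g e'"]) (auto simp: drawing_def)
    moreover have "fst e' \<in> V" "snd e' \<in> V" using edge_ends[OF e'(1)] by auto
    ultimately show False
      using e'(3) unfolding W_def by (auto intro: path_component_trans path_component_sym)
  qed
  then have "path_component ?K (snd e) (fst e)" unfolding W_def by simp
  then obtain p where p: "path p" "path_image p \<subseteq> ?K" "pathstart p = snd e" "pathfinish p = fst e"
    unfolding path_component_def by blast
  then obtain c where "arc c" "path_image c \<subseteq> path_image p" "pathstart c = snd e" "pathfinish c = fst e"
    using path_contains_arc[OF p(1,3,4)] edge_ends(3)[OF e] by metis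
  then show thesis using that p by blast
qed

text \<open>
  There is more than one face, since every edge lies on a Jordan curve. Fewer than four boundary
  edges would not separate the face of \<open>x\<close> from the others.
\<close>

lemma every_face_has_four_edges:
  assumes x: "x \<notin> drawing E"
  shows "4 \<le> card {e \<in> E. bounds e x}"
proof (rule ccontr)
  assume "\<not> 4 \<le> card {e \<in> E. bounds e x}"
  then have few: "card {e \<in> E. bounds e x} \<le> 3" by simp
  obtain e where e: "e \<in> E" using nonempty by blast
  obtain c where c: "arc c" "path_image c \<subseteq> drawing (E - {e})" "pathstart c = snd e" "pathfinish c = fst e"
    using nonbridge[OF e] .
  obtain i j where off: "i \<notin> drawing E" "j \<notin> drawing E"
      and apart: "\<And>M. path_image (g e) \<union> path_image c \<subseteq> M \<Longrightarrow> \<not> connected_component (- M) i j"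
    using faces_on_both_sides[OF e c] by blast
  have comp: "connected_component (- drawing E) x y" if "y \<notin> drawing E" for y
  proof (rule boundary_edges_separate[OF x that few_edges_do_not_separate[OF _ few]])
    have "drawing {e \<in> E. bounds e x} \<subseteq> drawing E" by (rule drawing_mono) auto
    then show "x \<notin> drawing {e \<in> E. bounds e x}" "y \<notin> drawing {e \<in> E. bounds e x}"
      using x that by auto
  qed auto
  have "connected_component (- drawing E) i j"
    using comp[OF off(1)] comp[OF off(2)] by (meson connected_component_sym connected_component_trans)
  moreover have "path_image (g e) \<union> path_image c \<subseteq> drawing E"
    using c(2) drawing_remove[OF e] by blast
  ultimately show False using apart by blast
qed

text \<open>
  The subgraph starts as a single vertex in a single face. While edges are left, one of them has an
  end in the subgraph: as long as vertices are missing, it crosses the cut that they form.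
\<close>

lemma exists_euler_witness:
  assumes "n \<le> card E"
  shows "\<exists>W F X. euler_witness W F X \<and> card F = n"
  using assms
proof (induction n)
  case 0
  obtain e where e: "e \<in> E" using nonempty by blast
  have "- drawing E \<noteq> {}"
    using compact_drawing[of E] by (metis Compl_eq_Compl_iff compact_imp_bounded double_compl
        not_bounded_UNIV order_refl Compl_UNIV_eq)
  then obtain x where "x \<notin> drawing E" by blast
  then have "euler_witness {fst e} {} {x}"
    using edge_ends[OF e] unfolding euler_witness_def plane_subgraph_def by auto
  then show ?case by (metis card.empty)
next
  case (Suc n)
  then obtain W F X where w: "euler_witness W F X" "card F = n" by auto
  then have F: "W \<subseteq> V" "W \<noteq> {}" "F \<subseteq> E" "F \<subseteq> W \<times> W" "finite F"
    using finite_E unfolding euler_witness_def by (auto intro: finite_subset)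
  have "\<exists>e\<in>E - F. fst e \<in> W \<or> snd e \<in> W"
  proof (cases "W = V")
    case True
    have "F \<noteq> E" using w Suc.prems by auto
    then show ?thesis using F edge_ends True by blast
  next
    case False
    then obtain e where "e \<in> E" "(fst e \<in> W) \<noteq> (snd e \<in> W)"
      using two_crossing_edges[OF F(1,2)] by blast
    then show ?thesis using F(4) by (intro bexI[of _ e]) auto
  qed
  then obtain e where e: "e \<in> E" "e \<notin> F" "fst e \<in> W \<or> snd e \<in> W" by blast
  have "card (insert e F) = Suc n" using w e F by simp
  then show ?case
    using euler_witness_cycle_edge[OF w(1) e(1,2)] euler_witness_pendant_edge[OF w(1) e(1,2)] e(3)
    by metis
qed

theorem edge_bound: "card E + 4 \<le> 2 * card V"
proof -
  obtain W F X where w: "euler_witness W F X" "card F = card E"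
    using exists_euler_witness by blast
  then have FE: "F = E" using finite_E unfolding euler_witness_def by (simp add: card_subset_eq)
  have W: "W \<subseteq> V" "finite X" "X \<inter> drawing E = {}" "card E + 2 \<le> card X + card W"
    using w FE unfolding euler_witness_def by auto
  have sep: "\<not> connected_component (- drawing E) x y" if "x \<in> X" "y \<in> X" "x \<noteq> y" for x y
  proof -
    have "plane_subgraph W E \<subseteq> drawing E" using W(1) unfolding plane_subgraph_def drawing_def by blast
    then show ?thesis
      using w that FE connected_component_of_subset[of "- drawing E" x y "- plane_subgraph W E"]
      unfolding euler_witness_def by blast
  qed
  have "4 * card X = (\<Sum>x\<in>X. 4)" by simp
  also have "\<dots> \<le> (\<Sum>x\<in>X. card {e \<in> E. bounds e x})"
    using every_face_has_four_edges W(3) by (intro sum_mono) blast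
  also have "\<dots> = (\<Sum>e\<in>E. card {x \<in> X. bounds e x})"
    using sum_multicount_gen[OF W(2) finite_E, of "\<lambda>x e. bounds e x"] by simp
  also have "\<dots> \<le> (\<Sum>e\<in>E. 2)"
  proof (rule sum_mono)
    fix e assume e: "e \<in> E"
    show "card {x \<in> X. bounds e x} \<le> 2"
      using nonbridge[OF e] edge_bounds_at_most_two_faces[OF e _ _ _ _ W(3) sep] by metis
  qed
  finally have "2 * card X \<le> card E" by simp
  moreover have "card W \<le> card V" using W(1) finite_A finite_B by (intro card_mono) auto
  ultimately show ?thesis using W(4) by linarith
qed

end

section \<open>Vertex connectivity and degrees\<close>

text \<open>
  Unlike walks, cuts are easily carried over from one graph to another: a cut of \<open>H\<close> lifts to a cut
  of its product with \<open>K\<^sub>2\<close>, a set of points in the plane pulls back to a cut of the abstract graph.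
\<close>

lemma connected_induce_subgraph_iff_cut:
  fixes G :: "'a pair_pre_digraph"
  assumes sym: "\<And>u v. (u, v) \<in> parcs G \<Longrightarrow> (v, u) \<in> parcs G"
  shows "Digraph_Component.connected (with_proj G \<restriction> U) \<longleftrightarrow>
    U \<noteq> {} \<and> (\<forall>W\<subseteq>U. W \<noteq> {} \<longrightarrow> W \<noteq> U \<longrightarrow> (\<exists>u\<in>W. \<exists>v\<in>U - W. (u, v) \<in> parcs G))"
    (is "_ \<longleftrightarrow> U \<noteq> {} \<and> ?cut")
proof -
  let ?R = "{(u, v). (u, v) \<in> parcs G \<and> u \<in> U \<and> v \<in> U}"
  have "arcs_ends (with_proj G \<restriction> U) = ?R"
    unfolding arcs_ends_def arc_to_ends_def induce_subgraph_def with_proj_def by force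
  moreover have "?R\<^sup>s = ?R" using sym unfolding symcl_def by auto
  ultimately have conn: "Digraph_Component.connected (with_proj G \<restriction> U) \<longleftrightarrow>
      U \<noteq> {} \<and> (\<forall>u\<in>U. \<forall>v\<in>U. (u, v) \<in> rtrancl_on U ?R)"
    by (simp add: connected_conv)
  have "?cut" if reach: "\<forall>u\<in>U. \<forall>v\<in>U. (u, v) \<in> rtrancl_on U ?R"
  proof (intro allI impI, rule ccontr)
    fix W assume W: "W \<subseteq> U" "W \<noteq> {}" "W \<noteq> U"
      and no: "\<not> (\<exists>u\<in>W. \<exists>v\<in>U - W. (u, v) \<in> parcs G)"
    obtain u v where uv: "u \<in> W" "v \<in> U" "v \<notin> W" using W by blast
    then have "(u, v) \<in> rtrancl_on U ?R" using reach W by blast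
    then have "v \<in> W" by (induction rule: rtrancl_on_induct) (use uv no in auto)
    with uv show False by simp
  qed
  moreover have "(u, v) \<in> rtrancl_on U ?R" if cut: "?cut" and uv: "u \<in> U" "v \<in> U" for u v
  proof -
    let ?W = "{w. (u, w) \<in> rtrancl_on U ?R}"
    have W: "?W \<subseteq> U" "u \<in> ?W" using uv by (auto dest: in_rtrancl_on_in_F)
    have "?W = U"
    proof (rule ccontr)
      assume "?W \<noteq> U"
      then obtain s t where "s \<in> ?W" "t \<in> U - ?W" "(s, t) \<in> parcs G" using cut W by blast
      moreover from this have "(s, t) \<in> ?R" using W by auto
      ultimately show False using rtrancl_on_into_rtrancl_on[of u s U ?R t] by blast
    qed
    then show ?thesis using uv by blast
  qed
  ultimately show ?thesis unfolding conn by blast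
qed

lemma out_degree_with_proj: "out_degree (with_proj G) v = card {w. (v, w) \<in> parcs G}"
proof -
  have "out_arcs (with_proj G) v = Pair v ` {w. (v, w) \<in> parcs G}"
    by (auto simp: out_arcs_def)
  then show ?thesis unfolding out_degree_def by (simp add: card_image inj_on_def)
qed

lemma k_connected_cut:
  assumes "pair_graph G" "k_connected k G" "S \<subseteq> pverts G" "card S < k"
    "W \<subseteq> pverts G - S" "W \<noteq> {}" "W \<noteq> pverts G - S"
  shows "\<exists>u\<in>W. \<exists>v\<in>pverts G - S - W. (u, v) \<in> parcs G"
proof -
  interpret pair_graph G by fact
  have "Digraph_Component.connected (with_proj G \<restriction> (pverts G - S))"
    using assms(2-4) unfolding k_connected_def by blast
  then show ?thesis
    using assms(5-7) connected_induce_subgraph_iff_cut[of G "pverts G - S"] arcs_symmetric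
    by blast
qed

text \<open>
  If \<open>v\<close> had fewer than \<open>k\<close> neighbours, then removing them would leave \<open>v\<close> isolated, but not as the
  only vertex, because there are more than \<open>k\<close> vertices.
\<close>

lemma k_connected_degree_ge:
  assumes G: "pair_graph G" and k: "k_connected k G" and v: "v \<in> pverts G"
  shows "k \<le> out_degree (with_proj G) v"
proof (rule ccontr)
  interpret pair_graph G by fact
  let ?N = "{w. (v, w) \<in> parcs G}"
  assume "\<not> k \<le> out_degree (with_proj G) v"
  then have N: "card ?N < k" by (simp add: out_degree_with_proj)
  have sub: "?N \<subseteq> pverts G" "v \<notin> ?N" using wellformed' no_loops' by blast+
  have "card (pverts G - ?N) = card (pverts G) - card ?N"
    using sub pair_finite_verts by (intro card_Diff_subset) (auto intro: finite_subset)
  moreover have "k < card (pverts G)" using k unfolding k_connected_def by blast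
  ultimately have "card (pverts G - ?N) > card {v}" using N by simp
  then have "{v} \<noteq> pverts G - ?N" by (metis less_irrefl)
  then obtain u where "u \<in> pverts G - ?N" "(v, u) \<in> parcs G"
    using k_connected_cut[OF G k sub(1) N, of "{v}"] v sub(2) by auto
  then show False by simp
qed

lemma min_degree_eqI:
  assumes "pair_graph G" "\<And>v. v \<in> pverts G \<Longrightarrow> k \<le> out_degree (with_proj G) v"
    "w \<in> pverts G" "out_degree (with_proj G) w \<le> k"
  shows "min_degree G = k"
proof -
  interpret pair_graph G by fact
  show ?thesis unfolding min_degree_def
    using assms(2-4) pair_finite_verts by (intro Min_eqI) force+
qed

text \<open>
  One crossing arc \<open>(u, v)\<close> comes from connectedness, another one either from the connectedness after
  removal of \<open>u\<close> or, if \<open>U = {u}\<close>, from the degree of \<open>u\<close>.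
\<close>

lemma three_connected_two_crossing_arcs:
  assumes G: "pair_graph G" and k: "k_connected 3 G" and U: "U \<subseteq> pverts G" "U \<noteq> {}" "U \<noteq> pverts G"
  obtains u v u' v' where "(u, v) \<in> parcs G" "(u', v') \<in> parcs G" "(u, v) \<noteq> (u', v')"
    "u \<in> U" "u' \<in> U" "v \<notin> U" "v' \<notin> U"
proof -
  interpret pair_graph G by fact
  obtain u v where uv: "u \<in> U" "v \<notin> U" "(u, v) \<in> parcs G"
    using k_connected_cut[OF G k, of "{}" U] U by auto
  show thesis
  proof (cases "U = {u}")
    case True
    have "{w. (u, w) \<in> parcs G} \<noteq> {v}"
      using k_connected_degree_ge[OF G k, of u] uv U by (auto simp: out_degree_with_proj)
    then obtain v' where "(u, v') \<in> parcs G" "v' \<noteq> v" using uv by blast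
    then show thesis using that[OF uv(3), of u v'] True uv no_loops'[of u v'] by auto
  next
    case False
    have "v \<in> pverts G" "u \<noteq> v" using uv wellformed' by auto
    then obtain u' v' where "u' \<in> U - {u}" "v' \<in> pverts G - {u} - (U - {u})" "(u', v') \<in> parcs G"
      using k_connected_cut[OF G k, of "{u}" "U - {u}"] U uv False by auto
    then show thesis using that[OF uv(3), of u' v'] uv by auto
  qed
qed

text \<open>
  If all degrees were at least four, then counting edges at either colour class would give
  \<open>\<bar>E\<bar> \<ge> 2\<bar>V\<bar>\<close>, against \<open>edge_bound\<close>. To apply that bound, vertices are replaced by their positions, and
  of the two orientations of an edge the one from \<open>A\<close> to \<open>B\<close> is kept.
\<close>

theorem three_connected_planar_bipartite_low_degree:
  assumes G: "pair_graph G" and planar: "planar G" and k: "k_connected 3 G"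
    and V: "pverts G = A \<union> B" "A \<inter> B = {}" and bip: "parcs G \<subseteq> A \<times> B \<union> B \<times> A"
  obtains (low_degree) v where "v \<in> pverts G" "out_degree (with_proj G) v \<le> 3"
proof (rule ccontr)
  interpret pair_graph G by fact
  assume "\<not> thesis"
  then have deg: "4 \<le> card {w. (v, w) \<in> parcs G}" if "v \<in> pverts G" for v
    using \<open>\<not> thesis\<close> that out_degree_with_proj[of G v] not_less_eq_eq[of 3] low_degree by fastforce
  obtain pos \<gamma> where d: "plane_drawing G pos \<gamma>" using planar unfolding planar_def by blast
  then have inj: "inj_on pos (pverts G)"
    and \<gamma>: "\<And>u v. (u, v) \<in> parcs G \<Longrightarrow> Path_Connected.arc (\<gamma> (u, v)) \<and> pathstart (\<gamma> (u, v)) = pos u \<and>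
      pathfinish (\<gamma> (u, v)) = pos v \<and> path_image (\<gamma> (u, v)) \<inter> pos ` pverts G = {pos u, pos v}"
    and disj: "\<And>u v x y. (u, v) \<in> parcs G \<Longrightarrow> (x, y) \<in> parcs G \<Longrightarrow> {u, v} \<noteq> {x, y} \<Longrightarrow>
      path_image (\<gamma> (u, v)) \<inter> path_image (\<gamma> (x, y)) \<subseteq> pos ` ({u, v} \<inter> {x, y})"
    unfolding plane_drawing_def by blast+
  define f where "f = inv_into (pverts G) pos"
  have f: "f (pos u) = u" if "u \<in> pverts G" for u using inj that by (simp add: f_def)
  define arcsAB where "arcsAB = parcs G \<inter> A \<times> B"
  define E where "E = map_prod pos pos ` arcsAB"
  define g where "g e = \<gamma> (map_prod f f e)" for e
  have posV: "pos ` A \<union> pos ` B = pos ` pverts G" using V by blast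
  have E_cases: "\<exists>u v. e = (pos u, pos v) \<and> (u, v) \<in> parcs G \<and> u \<in> A \<and> v \<in> B \<and> g e = \<gamma> (u, v)"
    if e: "e \<in> E" for e
  proof -
    obtain u v where uv: "e = (pos u, pos v)" "(u, v) \<in> parcs G" "u \<in> A" "v \<in> B"
      using e unfolding E_def arcsAB_def by auto
    then have "g e = \<gamma> (u, v)" using f V(1) unfolding g_def by simp
    with uv show ?thesis by blast
  qed
  have fin: "finite A" "finite B" using pair_finite_verts V by simp_all
  have crossing: "\<exists>e\<in>E. \<exists>e'\<in>E. e \<noteq> e' \<and> (fst e \<in> W) \<noteq> (snd e \<in> W) \<and> (fst e' \<in> W) \<noteq> (snd e' \<in> W)"
    if W: "W \<subseteq> pos ` A \<union> pos ` B" "W \<noteq> {}" "W \<noteq> pos ` A \<union> pos ` B" for W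
  proof -
    let ?U = "{v \<in> pverts G. pos v \<in> W}"
    \<comment> \<open>Here the two crossing edges may still be oriented either way.\<close>
    have U: "?U \<subseteq> pverts G" "?U \<noteq> {}" "?U \<noteq> pverts G" using W unfolding posV by blast+
    obtain u v u' v' where uv: "(u, v) \<in> parcs G" "(u', v') \<in> parcs G" "(u, v) \<noteq> (u', v')"
        "u \<in> ?U" "u' \<in> ?U" "v \<notin> ?U" "v' \<notin> ?U"
      by (rule three_connected_two_crossing_arcs[OF G k U])
    have in_V: "v \<in> pverts G" "v' \<in> pverts G" using uv wellformed' by auto
    have orient: "\<exists>e\<in>E. e = (pos s, pos t) \<or> e = (pos t, pos s)" if st: "(s, t) \<in> parcs G" for s t
    proof -
      have "(s, t) \<in> arcsAB \<or> (t, s) \<in> arcsAB"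
        using st arcs_symmetric[OF st] bip unfolding arcsAB_def by blast
      then show ?thesis unfolding E_def by force
    qed
    obtain e e' where e: "e \<in> E" "e = (pos u, pos v) \<or> e = (pos v, pos u)"
      and e': "e' \<in> E" "e' = (pos u', pos v') \<or> e' = (pos v', pos u')"
      using orient[OF uv(1)] orient[OF uv(2)] by blast
    \<comment> \<open>The ends in \<open>W\<close> tell which orientation was chosen, so different arcs give different edges.\<close>
    have "pos u \<noteq> pos u' \<or> pos v \<noteq> pos v'"
      using uv(3-5) in_V inj by (auto dest: inj_onD)
    moreover have W: "pos u \<in> W" "pos u' \<in> W" "pos v \<notin> W" "pos v' \<notin> W"
      using uv in_V by auto
    ultimately have "e \<noteq> e'" using e(2) e'(2) by auto
    moreover have "(fst e \<in> W) \<noteq> (snd e \<in> W)" "(fst e' \<in> W) \<noteq> (snd e' \<in> W)"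
      using e(2) e'(2) W by auto
    ultimately show ?thesis using e(1) e'(1) by blast
  qed
  have card4: "card (pverts G) > 3" using k unfolding k_connected_def by blast
  then have "pverts G \<noteq> {}" by auto
  then obtain v where v: "v \<in> pverts G" by blast
  have "E \<noteq> {}"
  proof -
    have "pos ` pverts G \<noteq> {pos v}"
      using card4 card_image[OF inj] by (auto dest: arg_cong[where f = card])
    then show ?thesis using crossing[of "{pos v}"] v unfolding posV by blast
  qed
  interpret drawn: two_edge_connected_plane_bipartite_graph "pos ` A" "pos ` B" E g
  proof
    show "pos ` A \<inter> pos ` B = {}" using V inj by (auto dest: inj_onD)
    show "E \<subseteq> pos ` A \<times> pos ` B" unfolding E_def arcsAB_def by auto
    fix e assume e: "e \<in> E"
    then show "Path_Connected.arc (g e)" "pathstart (g e) = fst e" "pathfinish (g e) = snd e"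
        "path_image (g e) \<inter> (pos ` A \<union> pos ` B) = {fst e, snd e}"
      using E_cases[OF e] \<gamma> unfolding posV by (metis fst_conv snd_conv)+
    fix e' assume e': "e' \<in> E" "e \<noteq> e'"
    obtain u v where uv: "e = (pos u, pos v)" "(u, v) \<in> parcs G" "u \<in> A" "v \<in> B" "g e = \<gamma> (u, v)"
      using E_cases[OF e] by blast
    obtain s t where st: "e' = (pos s, pos t)" "(s, t) \<in> parcs G" "s \<in> A" "t \<in> B" "g e' = \<gamma> (s, t)"
      using E_cases[OF e'(1)] by blast
    have "{u, v} \<noteq> {s, t}" using uv st e'(2) V(2) by (auto simp: doubleton_eq_iff)
    then show "path_image (g e) \<inter> path_image (g e') \<subseteq> {fst e, snd e} \<inter> {fst e', snd e'}"
      using disj[OF uv(2) st(2)] uv(1,5) st(1,5) by auto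
  qed (use fin crossing \<open>E \<noteq> {}\<close> in auto)
  have deg_sum: "4 * card X \<le> card (parcs G \<inter> X \<times> Y)"
    if "finite X" "X \<subseteq> pverts G" "parcs G \<inter> X \<times> UNIV \<subseteq> X \<times> Y" for X Y
  proof -
    have fin: "finite {w. (v, w) \<in> parcs G}" for v
      using pair_finite_verts wellformed' by (auto intro: finite_subset)
    have "4 * card X = (\<Sum>v\<in>X. 4)" by simp
    also have "\<dots> \<le> (\<Sum>v\<in>X. card {w. (v, w) \<in> parcs G})" using deg that by (intro sum_mono) auto
    also have "\<dots> = card (Sigma X (\<lambda>v. {w. (v, w) \<in> parcs G}))"
      using that(1) fin by (simp add: card_SigmaI)
    also have "Sigma X (\<lambda>v. {w. (v, w) \<in> parcs G}) = parcs G \<inter> X \<times> Y" using that(3) by auto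
    finally show ?thesis .
  qed
  have "4 * card A \<le> card arcsAB" unfolding arcsAB_def
    using fin V bip by (intro deg_sum) auto
  moreover have "4 * card B \<le> card (parcs G \<inter> B \<times> A)"
    using fin V bip by (intro deg_sum) auto
  moreover have "parcs G \<inter> B \<times> A = prod.swap ` arcsAB"
    unfolding arcsAB_def using arcs_symmetric by (force simp: image_iff)
  then have "card (parcs G \<inter> B \<times> A) = card arcsAB" by (simp add: card_image)
  moreover have "card E = card arcsAB"
  proof -
    have "arcsAB \<subseteq> pverts G \<times> pverts G" using V unfolding arcsAB_def by auto
    then have "inj_on (map_prod pos pos) arcsAB"
      using map_prod_inj_on[OF inj inj] by (rule inj_on_subset[rotated])
    then show ?thesis unfolding E_def by (rule card_image)
  qed
  moreover have "card (pos ` A \<union> pos ` B) = card A + card B"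
    using card_image[OF inj] card_Un_disjoint[OF fin V(2)] unfolding posV V(1) by simp
  ultimately show False using drawn.edge_bound by linarith
qed

section \<open>The Kronecker product with an edge\<close>

theorem proposition1p2:
  fixes H :: "'a pair_pre_digraph"
    and K2 :: "'b pair_pre_digraph"
    and P :: "('a \<times> 'b) pair_pre_digraph"
  assumes "pair_graph H"
    and "complete_digraph 2 (with_proj K2)"
    and "P = kronecker_product H K2"
    and "three_polytope P"
  shows "min_degree P = min_degree H \<and> min_degree H = 3 \<and>
    has_vertex_connectivity P 3 \<and>
    (has_vertex_connectivity H 2 \<or> has_vertex_connectivity H 3)"
proof -
  interpret H: pair_graph H by fact
  obtain x y where xy: "pverts K2 = {x, y}" "x \<noteq> y" "parcs K2 = {(x, y), (y, x)}"
    using assms(2) unfolding complete_digraph_pair_def card_2_iff by auto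
  have "graph (with_proj K2)" using assms(2) unfolding complete_digraph_def by simp
  then have P: "pair_graph P"
    using assms(1,3) pair_graphI_graph pair_graph_kronecker_product by metis
  have P3: "planar P" "k_connected 3 P" using assms(4) unfolding three_polytope_def by auto
  have vP: "pverts P = pverts H \<times> {x, y}"
    and aP: "parcs P = {((a, s), (b, t)) |a s b t. (a, b) \<in> parcs H \<and> (s, t) \<in> {(x, y), (y, x)}}"
    using assms(3) xy by (simp_all add: kronecker_product_def)
  have deg: "out_degree (with_proj P) (a, s) = out_degree (with_proj H) a" if "s \<in> {x, y}" for a s
  proof -
    have "{w. ((a, s), w) \<in> parcs P} =
        (\<lambda>b. (b, if s = x then y else x)) ` {b. (a, b) \<in> parcs H}"
      using that xy(2) unfolding aP by auto
    then show ?thesis unfolding out_degree_with_proj by (simp add: card_image inj_on_def)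
  qed
  have "pverts P = pverts H \<times> {x} \<union> pverts H \<times> {y}"
      "(pverts H \<times> {x}) \<inter> (pverts H \<times> {y}) = {}"
    using xy(2) unfolding vP by auto
  moreover have "parcs P \<subseteq> (pverts H \<times> {x}) \<times> (pverts H \<times> {y}) \<union> (pverts H \<times> {y}) \<times> (pverts H \<times> {x})"
    unfolding aP using H.wellformed' by auto
  ultimately obtain v where "v \<in> pverts P" "out_degree (with_proj P) v \<le> 3"
    by (rule three_connected_planar_bipartite_low_degree[OF P P3])
  then obtain a s where as: "a \<in> pverts H" "s \<in> {x, y}" "out_degree (with_proj P) (a, s) \<le> 3"
      "(a, s) \<in> pverts P"
    unfolding vP by blast
  have minP: "min_degree P = 3"
    using min_degree_eqI[OF P _ as(4,3)] k_connected_degree_ge[OF P P3(2)] by blast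
  have minH: "min_degree H = 3"
  proof (rule min_degree_eqI[OF assms(1) _ as(1)])
    show "out_degree (with_proj H) a \<le> 3" using as deg by simp
    show "3 \<le> out_degree (with_proj H) b" if "b \<in> pverts H" for b
      using k_connected_degree_ge[OF P P3(2), of "(b, x)"] that deg[of x b] vP by simp
  qed
  have P4: "\<not> k_connected (3 + 1) P" using k_connected_degree_ge[OF P _ as(4)] as(3) by fastforce
  have H4: "\<not> k_connected (3 + 1) H"
    using k_connected_degree_ge[OF assms(1) _ as(1)] as(2,3) deg by fastforce
  have cardH: "2 < card (pverts H)"
  proof -
    have "card {b. (a, b) \<in> parcs H} \<ge> 3"
      using k_connected_degree_ge[OF P P3(2) as(4)] deg[OF as(2)] by (simp add: out_degree_with_proj)
    moreover have "card {b. (a, b) \<in> parcs H} \<le> card (pverts H)"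
      using H.wellformed' H.pair_finite_verts by (intro card_mono) auto
    ultimately show ?thesis by linarith
  qed
  have H2: "k_connected 2 H"
    unfolding k_connected_def
  proof (intro conjI allI impI cardH)
    fix S assume S: "S \<subseteq> pverts H" "card S < 2"
    have finS: "finite S" using S H.pair_finite_verts finite_subset by blast
    \<comment> \<open>At most one vertex of \<open>H\<close> is removed, so at most two vertices of \<open>P\<close>.\<close>
    have S': "S \<times> {x, y} \<subseteq> pverts P" "card (S \<times> {x, y}) < 3"
      using S xy(2) by (auto simp: vP card_cartesian_product)
    have "pverts H - S \<noteq> {}" using S cardH card_mono[OF finS, of "pverts H"] by auto
    moreover have "\<exists>u\<in>W. \<exists>v\<in>pverts H - S - W. (u, v) \<in> parcs H"
      if W: "W \<subseteq> pverts H - S" "W \<noteq> {}" "W \<noteq> pverts H - S" for W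
    proof -
      have "W \<times> {x, y} \<subseteq> pverts P - S \<times> {x, y}" "W \<times> {x, y} \<noteq> {}"
          "W \<times> {x, y} \<noteq> pverts P - S \<times> {x, y}"
        using W unfolding vP by blast+
      then obtain p q where "p \<in> W \<times> {x, y}" "q \<in> pverts P - S \<times> {x, y} - W \<times> {x, y}"
          "(p, q) \<in> parcs P"
        using k_connected_cut[OF P P3(2) S'] by metis
      then show ?thesis unfolding vP aP by blast
    qed
    ultimately show "Digraph_Component.connected (with_proj H \<restriction> (pverts H - S))"
      using connected_induce_subgraph_iff_cut[of H] H.arcs_symmetric by blast
  qed
  show ?thesis
    using minP minH P3(2) P4 H2 H4 unfolding has_vertex_connectivity_def by auto
qed

end
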